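(* Let $X$ be a Wixarika poset, and let $w$ be a word (a term built from the unary operation $D$ and the binary operation $*$, with leaves labelled by the one-point poset $\mathbf{1}$) whose evaluation on the leaves $\mathbf{1}$ is $X$. Let $f(x)=\zeta_X(x)$, the strict order series of $X$ (equivalently, the power series obtained from $w$ by replacing every leaf by $\zeta_1$ and evaluating the operations on order series). Then: 1. $f$ admits a unique description $f(x)=d_i\zeta_i+d_{i+1}\zeta_{i+1}+\cdots+d_k\zeta_k$ with $d_i,\dots,d_k$ non-negative integers and $d_i\neq 0\neq d_k$. 2. $i$ is the number of points in a chain of maximum cardinality in $X$. 3. $k$ is the number of points of $X$. 4. $d=k-i$ is the first Betti number of the Hasse diagram of $X$, and it equals the number of occurrences of $D$ in $w$. 5. $m=i-2d-1$ is the number of occurrences of $*$ in $w$. 6. $m+1$ is the number of leaves of the tree $w$. 7. $\sum_{u=1}^{k}(-1)^{k-u}d_u=1$, where $d_u:=0$ for $u<i$.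
   Context: All posets are finite. For $n\ge1$, $\mathbf{n}$ denotes the chain $\{1<2<\cdots<n\}$. For a poset $X$, $\Omega^\circ_X(n)$ is the number of strict order preserving maps $X\to\mathbf{n}$ (maps $g$ with $a<b\Rightarrow g(a)<g(b)$), and the strict order series of $X$ is $\zeta_X(x)=\sum_{n\ge1}\Omega^\circ_X(n)x^n$. For $n\ge1$ write $\zeta_n(x)=\zeta_{\mathbf n}(x)=\frac{x^n}{(1-x)^{n+1}}$. The concatenation $X*Y$ of posets $X,Y$ is the disjoint union of $X$ and $Y$, keeping the orders of $X$ and $Y$ and additionally declaring $a<b$ for every $a\in X$, $b\in Y$. For a poset $X$, $D(X)=\mathbf{1}*(\mathbf{1}\sqcup X)*\mathbf{1}$, where $\sqcup$ is disjoint union with no relations between the two parts; i.e. $D(X)$ is $X$ with a new minimum $x_0$, a new maximum $x_1$, and a new element $y$ with $x_0<y<x_1$ incomparable to all elements of $X$. A Wixarika poset is a finite poset obtained from $\mathbf{1}$ by iterated application of $D$ and $*$. The Hasse diagram is regarded as an undirected graph; its first Betti number is the number of independent cycles (edges minus vertices plus number of connected components). *)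

theory Defs
  imports
    "HOL-Library.FuncSet"
    "HOL-Library.Countable"
    "HOL-Computational_Algebra.Formal_Power_Series"
begin

text \<open>
  A finite poset is a finite relation r satisfying \<^const>\<open>Partial_order\<close>; its set of points is
  \<^term>\<open>Field r\<close>, and (a, b) in r means that a is less than or equal to b.
\<close>

definition finite_poset :: "'a rel \<Rightarrow> bool" where
  "finite_poset r \<longleftrightarrow> Partial_order r \<and> finite r"

text \<open>By \<open>iso_iff2\<close>, \<^const>\<open>iso\<close> is order isomorphism for arbitrary relations, although the
  library introduces it in the context of well-orders.\<close>

definition isomorphic :: "'a rel \<Rightarrow> 'b rel \<Rightarrow> bool" where
  "isomorphic r s \<longleftrightarrow> (\<exists>f. iso r s f)"

definition chain_poset :: "nat \<Rightarrow> nat rel" where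
  "chain_poset n = {(a, b). 1 \<le> a \<and> a \<le> b \<and> b \<le> n}"

definition poset_sum :: "'a rel \<Rightarrow> 'b rel \<Rightarrow> ('a + 'b) rel" where
  "poset_sum r s = dir_image r Inl \<union> dir_image s Inr"

definition poset_concat :: "'a rel \<Rightarrow> 'b rel \<Rightarrow> ('a + 'b) rel" where
  "poset_concat r s = poset_sum r s \<union> (Inl ` Field r) \<times> (Inr ` Field s)"

definition poset_D :: "'a rel \<Rightarrow> (nat + (nat + 'a) + nat) rel" where
  "poset_D r =
     poset_concat (chain_poset 1) (poset_concat (poset_sum (chain_poset 1) r) (chain_poset 1))"

datatype word = Leaf | D word | Conc word word

text \<open>The operations change the underlying type, so each result is transported back to the natural
  numbers along the injection \<^const>\<open>to_nat\<close>. Only the isomorphism type of the result matters.\<close>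

primrec eval_word :: "word \<Rightarrow> nat rel" where
  "eval_word Leaf = chain_poset 1"
| "eval_word (D w) = dir_image (poset_D (eval_word w)) to_nat"
| "eval_word (Conc v w) = dir_image (poset_concat (eval_word v) (eval_word w)) to_nat"

definition wixarika :: "'a rel \<Rightarrow> bool" where
  "wixarika r \<longleftrightarrow> finite_poset r \<and> (\<exists>w. isomorphic (eval_word w) r)"

primrec count_D :: "word \<Rightarrow> nat" where
  "count_D Leaf = 0"
| "count_D (D w) = Suc (count_D w)"
| "count_D (Conc v w) = count_D v + count_D w"

primrec count_Conc :: "word \<Rightarrow> nat" where
  "count_Conc Leaf = 0"
| "count_Conc (D w) = count_Conc w"
| "count_Conc (Conc v w) = Suc (count_Conc v + count_Conc w)"

primrec count_leaves :: "word \<Rightarrow> nat" where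
  "count_leaves Leaf = 1"
| "count_leaves (D w) = count_leaves w"
| "count_leaves (Conc v w) = count_leaves v + count_leaves w"

text \<open>Maps are taken extensional outside \<^term>\<open>Field r\<close>, so that each map is counted once.\<close>

definition strict_maps :: "'a rel \<Rightarrow> nat \<Rightarrow> ('a \<Rightarrow> nat) set" where
  "strict_maps r n =
     {g \<in> Field r \<rightarrow>\<^sub>E {1..n}. \<forall>a b. (a, b) \<in> r \<and> a \<noteq> b \<longrightarrow> g a < g b}"

definition order_series :: "'a rel \<Rightarrow> int fps" where
  "order_series r = Abs_fps (\<lambda>n. if n = 0 then 0 else int (card (strict_maps r n)))"

definition zeta :: "nat \<Rightarrow> int fps" where
  "zeta n = order_series (chain_poset n)"

text \<open>
  The operations on order series induced by the operations on posets. A strict map on a disjoint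
  union is a pair of strict maps, so disjoint union induces the coefficientwise (Hadamard) product.
  Concatenation induces \<open>(1 - x) f g\<close>: on \<open>\<zeta>\<^sub>m\<close> and \<open>\<zeta>\<^sub>n\<close> this gives
  \<open>(1 - x) x\<^sup>m x\<^sup>n / ((1 - x)\<^sup>m\<^sup>+\<^sup>1 (1 - x)\<^sup>n\<^sup>+\<^sup>1) = \<zeta>\<^sub>m\<^sub>+\<^sub>n\<close>.
\<close>

definition series_sum :: "int fps \<Rightarrow> int fps \<Rightarrow> int fps" where
  "series_sum f g = Abs_fps (\<lambda>n. fps_nth f n * fps_nth g n)"

definition series_concat :: "int fps \<Rightarrow> int fps \<Rightarrow> int fps" where
  "series_concat f g = (1 - fps_X) * f * g"

definition series_D :: "int fps \<Rightarrow> int fps" where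
  "series_D f = series_concat (zeta 1) (series_concat (series_sum (zeta 1) f) (zeta 1))"

primrec eval_series :: "word \<Rightarrow> int fps" where
  "eval_series Leaf = zeta 1"
| "eval_series (D w) = series_D (eval_series w)"
| "eval_series (Conc v w) = series_concat (eval_series v) (eval_series w)"

text \<open>The coefficients are padded by zero outside \<open>{i..k}\<close>, so that a description is determined by
  \<open>i\<close>, \<open>k\<close> and the function \<open>d\<close>.\<close>

definition zeta_description :: "int fps \<Rightarrow> nat \<times> nat \<times> (nat \<Rightarrow> nat) \<Rightarrow> bool" where
  "zeta_description f = (\<lambda>(i, k, d).
     1 \<le> i \<and> i \<le> k \<and> d i \<noteq> 0 \<and> d k \<noteq> 0 \<and> (\<forall>u. u \<notin> {i..k} \<longrightarrow> d u = 0) \<and>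
     f = (\<Sum>u=i..k. of_nat (d u) * zeta u))"

text \<open>For a reflexive relation, the sets in \<^term>\<open>Chains r\<close> are subsets of \<^term>\<open>Field r\<close>.\<close>

definition max_chain_card :: "'a rel \<Rightarrow> nat" where
  "max_chain_card r = Max (card ` Chains r)"

definition covers :: "'a rel \<Rightarrow> 'a rel" where
  "covers r = {(a, b) \<in> r. a \<noteq> b \<and> \<not> (\<exists>c. c \<noteq> a \<and> c \<noteq> b \<and> (a, c) \<in> r \<and> (c, b) \<in> r)}"

definition hasse_edges :: "'a rel \<Rightarrow> 'a set set" where
  "hasse_edges r = {{a, b} | a b. (a, b) \<in> covers r}"

definition components :: "'a set \<Rightarrow> 'a set set \<Rightarrow> 'a set set" where
  "components V E = V // {(a, b) \<in> V \<times> V. (a, b) \<in> {(x, y). {x, y} \<in> E}\<^sup>*}"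

definition betti_number :: "'a set \<Rightarrow> 'a set set \<Rightarrow> int" where
  "betti_number V E = int (card E) - int (card V) + int (card (components V E))"

end

theory Submission
  imports Defs "HOL-Computational_Algebra.Polynomial"
begin

text \<open>
  Identify \<open>\<zeta>\<^sub>u\<close> with the monomial \<open>t\<^sup>u\<close>. Concatenation then becomes the product of polynomials, and
  \<open>D\<close> becomes \<open>p \<mapsto> t\<^sup>3 ((1 + t) p)'\<close>, because the Hadamard product with \<open>\<zeta>\<^sub>1\<close> is \<open>x d/dx\<close>. A word thus
  yields an integer polynomial with non-negative coefficients, whose order at 0, degree, and value
  at -1 are computed by induction on the word; \<open>((1 + t) p)'\<close> and \<open>p\<close> agree at -1. On the side of
  posets, every Wixarika poset has exactly one minimal and one maximal element, so its Hasse diagram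
  is connected and concatenation adds one edge while \<open>D\<close> adds four edges and three points.
\<close>

section \<open>Polynomials and order series\<close>

text \<open>Chain length and number of points are never derived from the series. The counts for
  \<open>X\<close> on one side, and the order at 0 and the degree of the polynomial on the other,
  are each computed as linear expressions in the numbers of \<open>*\<close> and \<open>D\<close>,
  and these expressions are compared. One \<open>D\<close> raises the order by 2 and the degree by
  3, so the gap \<open>k - i\<close> counts the occurrences of \<open>D\<close>. Uniqueness of the
  description is injectivity of the passage from polynomials to series. The coefficient ring is the
  integers because -1 is substituted: the alternating sum is \<open>(-1)^k p(-1)\<close>, and it
  equals 1 because both operations preserve \<open>p(-1) = (-1)^(degree p)\<close>.\<close>

definition geom :: "int fps" where
  "geom = Abs_fps (\<lambda>_. 1)"

text \<open>So \<open>geom\<close> is \<open>1/(1 - x)\<close>: dividing by \<open>1 - x\<close>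
  becomes multiplying by it, and all coefficients stay integers.\<close>

lemma one_minus_X_geom: "(1 - fps_X) * geom = 1"
proof (rule fps_ext)
  fix n
  show "fps_nth ((1 - fps_X) * geom) n = fps_nth 1 n"
    by (cases n) (simp_all add: geom_def left_diff_distrib)
qed

lemma geom_eq: "geom = 1 + fps_X * geom"
  using one_minus_X_geom by (simp add: algebra_simps)

lemma fps_deriv_geom: "fps_deriv geom = geom * geom"
proof -
  have "fps_deriv ((1 - fps_X) * geom) = 0"
    by (simp add: one_minus_X_geom)
  then have "(1 - fps_X) * fps_deriv geom = geom"
    by simp
  then have "geom * ((1 - fps_X) * fps_deriv geom) = geom * geom"
    by simp
  then show ?thesis
    by (metis mult.assoc mult.commute mult_1 one_minus_X_geom)
qed

text \<open>The image of \<open>t\<^sup>u\<close> is \<open>x\<^sup>u / (1 - x)\<^sup>u\<^sup>+\<^sup>1\<close>, which is \<open>\<zeta>\<^sub>u\<close> for \<open>u \<ge> 1\<close>.\<close>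

definition zseries :: "int poly \<Rightarrow> int fps" where
  "zseries p = geom * poly (map_poly fps_const p) (fps_X * geom)"

lemma zseries_0 [simp]: "zseries 0 = 0"
  by (simp add: zseries_def)

text \<open>Horner's rule in \<open>y = x/(1 - x)\<close>; it drives the inductions on polynomials
  below.\<close>

lemma zseries_pCons:
  "zseries (pCons a p) = fps_const a * geom + fps_X * geom * zseries p"
  by (simp add: zseries_def map_poly_pCons algebra_simps)

lemma zseries_1: "zseries 1 = geom"
  by (simp add: one_pCons zseries_pCons)

lemma zseries_add: "zseries (p + q) = zseries p + zseries q"
proof (induction p q rule: poly_induct2)
  case (pCons a p b q)
  show ?case
    by (simp only: add_pCons zseries_pCons pCons.IH fps_const_add[symmetric] algebra_simps)
qed simp

lemma zseries_smult: "zseries (smult c p) = fps_const c * zseries p"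
proof (induction p)
  case (pCons a p)
  show ?case
    by (simp only: smult_pCons zseries_pCons pCons.IH fps_const_mult[symmetric] algebra_simps)
qed simp

lemma zseries_diff: "zseries (p - q) = zseries p - zseries q"
  using zseries_add[of "p - q" q] by simp

text \<open>Each image is \<open>geom\<close> times a polynomial in \<open>x/(1 - x)\<close>. The
  product of two images has one factor \<open>geom\<close> too many, which the factor
  \<open>1 - x\<close> of \<open>series_concat\<close> cancels.\<close>

lemma zseries_mult: "zseries (p * q) = series_concat (zseries p) (zseries q)"
proof -
  have *: "(1 - fps_X) * (geom * c) = c" for c
    by (metis mult.assoc mult_1 one_minus_X_geom)
  show ?thesis
  proof (induction p)
    case (pCons a p)
    have "zseries (pCons a p * q) = fps_const a * zseries q
        + fps_X * geom * ((1 - fps_X) * zseries p * zseries q)"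
      using pCons.IH
      by (simp add: mult_pCons_left zseries_add zseries_smult zseries_pCons series_concat_def)
    also have "\<dots> = (1 - fps_X) * (geom * (fps_const a * zseries q))
        + fps_X * geom * ((1 - fps_X) * zseries p * zseries q)"
      by (simp only: *)
    also have "\<dots> = series_concat (zseries (pCons a p)) (zseries q)"
      by (simp add: zseries_pCons series_concat_def algebra_simps)
    finally show ?case .
  qed (simp add: series_concat_def)
qed

text \<open>The constant term of the series recovers the lowest coefficient; what remains is a
  multiple of \<open>x/(1 - x)\<close>, which cancels. This is the linear independence behind
  uniqueness.\<close>

lemma zseries_eq_iff: "zseries p = zseries q \<longleftrightarrow> p = q"
proof -
  have "p = 0" if "zseries p = 0" for p
    using that
  proof (induction p)
    case (pCons a p)
    have nz: "fps_X * geom \<noteq> 0"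
      using one_minus_X_geom by auto
    have "fps_nth (zseries (pCons a p)) 0 = a"
      by (simp add: zseries_pCons geom_def mult.assoc)
    with pCons.prems have "a = 0" by simp
    with pCons.prems nz have "zseries p = 0"
      by (simp add: zseries_pCons)
    with pCons.IH \<open>a = 0\<close> show ?case by simp
  qed simp
  from this[of "p - q"] show ?thesis
    by (auto simp: zseries_diff)
qed

text \<open>The operator \<open>p \<mapsto> t ((1 + t) p)'\<close> sends \<open>t\<^sup>u\<close> to \<open>u t\<^sup>u + (u + 1) t\<^sup>u\<^sup>+\<^sup>1\<close>; on coefficients of series
  this is \<open>n (n choose u) = u (n choose u) + (u + 1) (n choose (u + 1))\<close>.\<close>

lemma zseries_pderiv:
  "zseries ([:0, 1:] * pderiv ([:1, 1:] * p)) = fps_X * fps_deriv (zseries p)"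
proof (induction p)
  case (pCons a p)
  \<comment> \<open>With \<open>y = x/(1 - x)\<close> this reads \<open>x y' = y + y^2\<close>, so
    \<open>x d/dx\<close> acts on polynomials in \<open>y\<close> as
    \<open>(y + y^2) d/dy\<close>.\<close>
  have g: "fps_X * geom * geom = fps_X * geom + fps_X * geom * (fps_X * geom)"
    by (subst (2) geom_eq) (simp add: algebra_simps)
  define r where "r = [:0, 1:] * pderiv ([:1, 1:] * p)"
  have r: "[:0, 1:] * pderiv ([:1, 1:] * pCons a p) = pCons 0 ([:a:] + ([:1, 1:] * p + r))"
    unfolding r_def by (simp add: pderiv_pCons pderiv_add pderiv_smult algebra_simps)
  have "zseries ([:0, 1:] * pderiv ([:1, 1:] * pCons a p))
      = fps_X * geom * (fps_const a * geom
          + ((zseries p + fps_X * geom * zseries p) + fps_X * fps_deriv (zseries p)))"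
    unfolding r using pCons.IH[folded r_def]
    by (simp add: zseries_pCons zseries_add)
  also have "\<dots> = fps_const a * (fps_X * geom * geom)
      + (fps_X * geom + fps_X * geom * (fps_X * geom)) * zseries p
      + fps_X * (fps_X * geom) * fps_deriv (zseries p)"
    by (simp add: algebra_simps)
  also have "\<dots> = fps_X * fps_deriv (zseries (pCons a p))"
  proof -
    have "fps_X * fps_deriv (zseries (pCons a p))
      = fps_const a * (fps_X * geom * geom)
      + (fps_X * geom + fps_X * (fps_X * geom * geom)) * zseries p
      + fps_X * (fps_X * geom) * fps_deriv (zseries p)"
      by (simp add: zseries_pCons fps_deriv_geom algebra_simps)
    also have "fps_X * geom + fps_X * (fps_X * geom * geom) = fps_X * (geom * (1 + fps_X * geom))"
      by (simp add: algebra_simps)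
    also have "\<dots> = fps_X * geom + fps_X * geom * (fps_X * geom)"
      by (simp add: algebra_simps)
    finally show ?thesis by (simp only:)
  qed
  finally show ?case .
qed simp

section \<open>The polynomial of a word\<close>

text \<open>The bracketing for \<open>D\<close> mirrors \<open>series_D\<close>: the outer factors
  \<open>t\<close> stand for the new minimum and maximum, the inner \<open>t ((1 + t) p)'\<close>
  for disjoint union with a point.\<close>

primrec word_poly :: "word \<Rightarrow> int poly" where
  "word_poly Leaf = [:0, 1:]"
| "word_poly (D w) = [:0, 1:] * (([:0, 1:] * pderiv ([:1, 1:] * word_poly w)) * [:0, 1:])"
| "word_poly (Conc v w) = word_poly v * word_poly w"

lemma word_poly_nonneg: "0 \<le> coeff (word_poly w) u"
proof -
  have X: "\<forall>u. 0 \<le> coeff ([:0, 1::int:]) u" "\<forall>u. 0 \<le> coeff ([:1, 1::int:]) u"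
    by (auto simp: coeff_pCons split: nat.splits)
  have m: "\<forall>u. 0 \<le> coeff (p * q) u" if "\<forall>u. 0 \<le> coeff p u" "\<forall>u. 0 \<le> coeff q u"
    for p q :: "int poly"
    using that by (auto simp: coeff_mult intro!: sum_nonneg)
  have d: "\<forall>u. 0 \<le> coeff (pderiv p) u" if "\<forall>u. 0 \<le> coeff p u" for p :: "int poly"
    using that by (auto simp: coeff_pderiv)
  have "\<forall>u. 0 \<le> coeff (word_poly w) u"
  proof (induction w)
    case Leaf
    then show ?case using X(1) by simp
  next
    case (D w)
    show ?case
      unfolding word_poly.simps by (rule m m[OF m] | rule d | rule X D)+
  next
    case (Conc v w)
    then show ?case
      unfolding word_poly.simps by (rule m)
  qed
  then show ?thesis by simp
qed

text \<open>One induction serves all four facts, since order and degree are additive on products of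
  nonzero polynomials. For \<open>D\<close>, the factor \<open>1 + t\<close> keeps the order and
  raises the degree by one, the derivative lowers both by one, and \<open>t^3\<close> adds 3 to both
  and flips the sign at -1. As 3 is odd, sign and parity of the degree stay in step.\<close>

lemma word_poly_neg_one: "poly (word_poly w) (- 1) = (- 1) ^ degree (word_poly w)"
  and word_poly_nonzero: "word_poly w \<noteq> 0"
  and order_word_poly: "order 0 (word_poly w) = 1 + count_Conc w + 2 * count_D w"
  and degree_word_poly: "degree (word_poly w) = 1 + count_Conc w + 3 * count_D w"
proof -
  have "word_poly w \<noteq> 0 \<and> order 0 (word_poly w) = 1 + count_Conc w + 2 * count_D w \<and>
    degree (word_poly w) = 1 + count_Conc w + 3 * count_D w \<and>
    poly (word_poly w) (- 1) = (- 1) ^ degree (word_poly w)"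
  proof (induction w)
    case Leaf
    then show ?case
      using order_0_monom[of "1::int" 1] by (simp add: monom_altdef)
  next
    case (D w)
    let ?q = "[:1, 1:] * word_poly w"
    have X: "order 0 [:0, 1::int:] = 1"
      using order_0_monom[of "1::int" 1] by (simp add: monom_altdef)
    have one: "order 0 [:1, 1::int:] = 0"
      by (rule order_0I) simp
    have q: "?q \<noteq> 0" "order 0 ?q = 1 + count_Conc w + 2 * count_D w"
      "degree ?q = 2 + count_Conc w + 3 * count_D w"
      using D one order_mult[of "[:1, 1:]" "word_poly w" 0] degree_mult_eq[of "[:1, 1:]" "word_poly w"]
      by (auto simp del: mult_pCons_left)
    \<comment> \<open>The derivative lowers the order at 0 by one only if 0 is a root.\<close>
    then have "poly ?q 0 = 0"
      by (metis add_is_0 one_neq_zero order_0I)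
    then have o: "order 0 ?q = Suc (order 0 (pderiv ?q))"
      using q(1) order_pderiv by blast
    have nz: "pderiv ?q \<noteq> 0"
      using q(3) degree_pderiv[of ?q] pderiv_eq_0_iff[of ?q] by auto
    have dg: "degree (pderiv ?q) = 1 + count_Conc w + 3 * count_D w"
      using q(3) degree_pderiv[of ?q] by simp
    \<comment> \<open>In the product rule, \<open>1 + t\<close> vanishes at -1 and has derivative
      1.\<close>
    have ev: "poly (pderiv ?q) (- 1) = poly (word_poly w) (- 1)"
      by (simp only: pderiv_mult) (simp add: pderiv_pCons)
    have X0: "[:0, 1::int:] \<noteq> 0" by simp
    have e: "word_poly (D w) = [:0, 1:] * (([:0, 1:] * pderiv ?q) * [:0, 1:])" by simp
    have prods: "[:0, 1::int:] * pderiv ?q \<noteq> 0" "([:0, 1:] * pderiv ?q) * [:0, 1:] \<noteq> 0"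
      "[:0, 1:] * (([:0, 1:] * pderiv ?q) * [:0, 1:]) \<noteq> 0"
      by (simp_all only: mult_eq_0_iff nz X0 simp_thms)
    have "order 0 (word_poly (D w)) = 1 + count_Conc (D w) + 2 * count_D (D w)"
      unfolding e using q(2) o X
      by (simp only: order_mult[OF prods(3)] order_mult[OF prods(2)] order_mult[OF prods(1)]) simp
    moreover have "degree (word_poly (D w)) = 1 + count_Conc (D w) + 3 * count_D (D w)"
      unfolding e degree_mult_eq[OF X0 prods(2)] degree_mult_eq[OF prods(1) X0]
        degree_mult_eq[OF X0 nz] dg by simp
    moreover have "poly (word_poly (D w)) (- 1) = - poly (word_poly w) (- 1)"
      unfolding e poly_mult ev by simp
    ultimately show ?case
      using D.IH prods(3) e by simp
  next
    case (Conc v w)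
    then show ?case
      by (auto simp: order_mult degree_mult_eq power_add)
  qed
  then show "poly (word_poly w) (- 1) = (- 1) ^ degree (word_poly w)" "word_poly w \<noteq> 0"
    "order 0 (word_poly w) = 1 + count_Conc w + 2 * count_D w"
    "degree (word_poly w) = 1 + count_Conc w + 3 * count_D w"
    by auto
qed

text \<open>\<open>t^n\<close> divides \<open>p\<close> exactly when the first \<open>n\<close>
  coefficients vanish. This is how the lower end \<open>i\<close> of a description is recognised as
  an order.\<close>

lemma order_0_eq_iff:
  fixes p :: "'a::idom poly"
  assumes "coeff p i \<noteq> 0" "\<And>j. j < i \<Longrightarrow> coeff p j = 0"
  shows "order 0 p = i"
proof -
  have "p \<noteq> 0" using assms(1) by auto
  then have "n \<le> order 0 p \<longleftrightarrow> (\<forall>k<n. coeff p k = 0)" for n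
    using monom_1_dvd_iff monom_1_dvd_iff' by blast
  from this[of i] this[of "Suc i"] show ?thesis
    using assms by (metis le_antisym lessI not_less_eq_eq)
qed

section \<open>Strict maps on sums and concatenations\<close>

text \<open>Puts an isomorphic copy into the form in which \<open>eval_word\<close> builds its
  posets, so that the same transport lemmas serve for \<open>X\<close> and for the encodings by
  \<open>to_nat\<close>.\<close>

lemma iso_imp_dir_image:
  fixes r :: "'a rel" and s :: "'b rel"
  assumes "iso r s f"
  shows "inj_on f (Field r)" and "s = dir_image r f"
proof -
  have f: "f ` Field r = Field s" and inj: "inj_on f (Field r)"
    and *: "\<And>a b. a \<in> Field r \<Longrightarrow> b \<in> Field r \<Longrightarrow> (a, b) \<in> r \<longleftrightarrow> (f a, f b) \<in> s"
    using assms unfolding iso_iff2 bij_betw_def by blast+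
  show "inj_on f (Field r)" by (rule inj)
  show "s = dir_image r f"
  proof (rule set_eqI)
    fix z :: "'b \<times> 'b"
    obtain x y where z: "z = (x, y)" by (rule prod.exhaust)
    have "(x, y) \<in> s \<longleftrightarrow> (\<exists>a b. x = f a \<and> y = f b \<and> (a, b) \<in> r)"
    proof
      assume xy: "(x, y) \<in> s"
      then obtain a b where "x = f a" "a \<in> Field r" "y = f b" "b \<in> Field r"
        using f by (metis FieldI1 FieldI2 imageE)
      then show "\<exists>a b. x = f a \<and> y = f b \<and> (a, b) \<in> r"
        using * xy by blast
    next
      assume "\<exists>a b. x = f a \<and> y = f b \<and> (a, b) \<in> r"
      then show "(x, y) \<in> s"
        using * by (metis FieldI1 FieldI2)
    qed
    then show "z \<in> s \<longleftrightarrow> z \<in> dir_image r f"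
      unfolding z by (simp add: dir_image_def)
  qed
qed

lemma mem_dir_image_iff:
  assumes "inj_on f (Field r)" "a \<in> Field r" "b \<in> Field r"
  shows "(f a, f b) \<in> dir_image r f \<longleftrightarrow> (a, b) \<in> r"
proof
  assume "(f a, f b) \<in> dir_image r f"
  then obtain a' b' where "f a = f a'" "f b = f b'" "(a', b') \<in> r"
    by (auto simp: dir_image_def)
  then show "(a, b) \<in> r"
    using assms by (metis FieldI1 FieldI2 inj_onD)
qed (auto simp: dir_image_def)

lemma Field_poset_sum [simp]: "Field (poset_sum r s) = Inl ` Field r \<union> Inr ` Field s"
  by (simp add: poset_sum_def dir_image_Field)

lemma Field_poset_concat [simp]: "Field (poset_concat r s) = Inl ` Field r \<union> Inr ` Field s"
proof -
  have "Field ((Inl ` Field r) \<times> (Inr ` Field s)) \<subseteq> Inl ` Field r \<union> Inr ` Field s"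
    by (auto simp: Field_def)
  then show ?thesis
    by (auto simp: poset_concat_def)
qed

lemma poset_sum_iff [simp]:
  "(Inl a, Inl b) \<in> poset_sum r s \<longleftrightarrow> (a, b) \<in> r"
  "(Inr x, Inr y) \<in> poset_sum r s \<longleftrightarrow> (x, y) \<in> s"
  "(Inl a, Inr y) \<notin> poset_sum r s"
  "(Inr x, Inl b) \<notin> poset_sum r s"
  by (auto simp: poset_sum_def dir_image_def)

lemma poset_concat_iff [simp]:
  "(Inl a, Inl b) \<in> poset_concat r s \<longleftrightarrow> (a, b) \<in> r"
  "(Inr x, Inr y) \<in> poset_concat r s \<longleftrightarrow> (x, y) \<in> s"
  "(Inl a, Inr y) \<in> poset_concat r s \<longleftrightarrow> a \<in> Field r \<and> y \<in> Field s"
  "(Inr x, Inl b) \<notin> poset_concat r s"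
  by (auto simp: poset_concat_def)

lemma Field_chain_poset [simp]: "Field (chain_poset n) = {1..n}"
  by (auto simp: chain_poset_def Field_def)

lemma inj_on_to_nat: "inj_on (to_nat :: 'a::countable \<Rightarrow> nat) A"
  by (rule inj_on_subset[OF inj_to_nat]) simp

text \<open>Allows value sets other than \<open>{1..n}\<close>: cutting a map on a concatenation
  leaves an upper part with values in \<open>{Suc j..n}\<close>.\<close>

definition maps_into :: "'a rel \<Rightarrow> nat set \<Rightarrow> ('a \<Rightarrow> nat) set" where
  "maps_into r A = {g \<in> Field r \<rightarrow>\<^sub>E A. \<forall>a b. (a, b) \<in> r \<and> a \<noteq> b \<longrightarrow> g a < g b}"

lemma strict_maps_eq_maps_into: "strict_maps r n = maps_into r {1..n}"
  by (simp add: strict_maps_def maps_into_def)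

lemma finite_maps_into: "finite (Field r) \<Longrightarrow> finite A \<Longrightarrow> finite (maps_into r A)"
  unfolding maps_into_def by (rule finite_subset[OF _ finite_PiE]) auto

lemma card_strict_maps_dir_image:
  assumes inj: "inj_on f (Field r)"
  shows "card (strict_maps (dir_image r f) n) = card (strict_maps r n)"
proof -
  let ?F = "\<lambda>g. restrict (g \<circ> f) (Field r)"
  let ?G = "\<lambda>h. restrict (h \<circ> inv_into (Field r) f) (f ` Field r)"
  have "bij_betw ?F (strict_maps (dir_image r f) n) (strict_maps r n)"
  proof (rule bij_betw_byWitness[where f' = ?G]; (intro ballI subsetI)?)
    fix g assume "g \<in> strict_maps (dir_image r f) n"
    then have "g \<in> extensional (f ` Field r)"
      by (auto simp: strict_maps_def dir_image_Field PiE_def)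
    then show "?G (?F g) = g"
      using inj by (auto simp: fun_eq_iff extensional_def)
  next
    fix h assume "h \<in> strict_maps r n"
    then have "h \<in> extensional (Field r)"
      by (auto simp: strict_maps_def PiE_def)
    then show "?F (?G h) = h"
      using inj by (auto simp: fun_eq_iff extensional_def)
  next
    fix k assume "k \<in> ?F ` strict_maps (dir_image r f) n"
    then obtain g where g: "g \<in> strict_maps (dir_image r f) n" and k: "k = ?F g" by blast
    have "g (f a) < g (f b)" if "(a, b) \<in> r" "a \<noteq> b" for a b
    proof -
      have "(f a, f b) \<in> dir_image r f" using that by (auto simp: dir_image_def)
      moreover have "f a \<noteq> f b"
        using that inj by (auto simp: inj_on_def dest: FieldI1 FieldI2)
      ultimately show ?thesis using g by (auto simp: strict_maps_def)
    qed
    then show "k \<in> strict_maps r n"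
      using g unfolding k by (auto simp: strict_maps_def dir_image_Field intro: FieldI1 FieldI2)
  next
    fix k assume "k \<in> ?G ` strict_maps r n"
    then obtain h where h: "h \<in> strict_maps r n" and k: "k = ?G h" by blast
    have "k x < k y" if "(x, y) \<in> dir_image r f" "x \<noteq> y" for x y
    proof -
      obtain a b where ab: "x = f a" "y = f b" "(a, b) \<in> r" "a \<noteq> b"
        using \<open>(x, y) \<in> dir_image r f\<close> \<open>x \<noteq> y\<close> by (auto simp: dir_image_def)
      then have "a \<in> Field r" "b \<in> Field r"
        by (blast intro: FieldI1 FieldI2)+
      then have "k x = h a" "k y = h b"
        using inj by (simp_all add: k ab)
      then show ?thesis using h ab by (auto simp: strict_maps_def)
    qed
    moreover have "k \<in> f ` Field r \<rightarrow>\<^sub>E {1..n}"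
      using h inj unfolding k by (auto simp: strict_maps_def)
    ultimately show "k \<in> strict_maps (dir_image r f) n"
      by (auto simp: strict_maps_def dir_image_Field)
  qed
  then show ?thesis by (rule bij_betw_same_card)
qed

lemma order_series_dir_image:
  "inj_on f (Field r) \<Longrightarrow> order_series (dir_image r f) = order_series r"
  by (rule fps_ext) (simp add: order_series_def card_strict_maps_dir_image)

lemma comp_Inl_Inr [simp]:
  "case_sum g h \<circ> Inl = g" "case_sum g h \<circ> Inr = h" "case_sum (k \<circ> Inl) (k \<circ> Inr) = k"
  by (auto simp: fun_eq_iff split: sum.splits)

lemma PiE_sum_iff:
  "k \<in> (Inl ` A \<union> Inr ` B) \<rightarrow>\<^sub>E C \<longleftrightarrow> k \<circ> Inl \<in> A \<rightarrow>\<^sub>E C \<and> k \<circ> Inr \<in> B \<rightarrow>\<^sub>E C"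
proof (intro iffI)
  assume *: "k \<circ> Inl \<in> A \<rightarrow>\<^sub>E C \<and> k \<circ> Inr \<in> B \<rightarrow>\<^sub>E C"
  show "k \<in> (Inl ` A \<union> Inr ` B) \<rightarrow>\<^sub>E C"
  proof
    fix x assume "x \<notin> Inl ` A \<union> Inr ` B"
    then show "k x = undefined"
      using * by (cases x) (auto simp: PiE_iff extensional_def)
  qed (use * in auto)
qed (auto simp: PiE_iff extensional_def)

lemma maps_into_poset_sum_iff:
  "k \<in> maps_into (poset_sum r s) A \<longleftrightarrow> k \<circ> Inl \<in> maps_into r A \<and> k \<circ> Inr \<in> maps_into s A"
  by (simp add: maps_into_def PiE_sum_iff split_sum_all all_conj_distrib conj_ac)

lemma maps_into_poset_concat_iff:
  "k \<in> maps_into (poset_concat r s) A \<longleftrightarrow> k \<circ> Inl \<in> maps_into r A \<and> k \<circ> Inr \<in> maps_into s A \<and>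
    (\<forall>a\<in>Field r. \<forall>b\<in>Field s. k (Inl a) < k (Inr b))"
proof -
  have "(\<forall>x y. (x, y) \<in> poset_concat r s \<and> x \<noteq> y \<longrightarrow> k x < k y) \<longleftrightarrow>
    (\<forall>a b. (a, b) \<in> r \<and> a \<noteq> b \<longrightarrow> k (Inl a) < k (Inl b)) \<and>
    (\<forall>a b. (a, b) \<in> s \<and> a \<noteq> b \<longrightarrow> k (Inr a) < k (Inr b)) \<and>
    (\<forall>a\<in>Field r. \<forall>b\<in>Field s. k (Inl a) < k (Inr b))"
    by (simp add: split_sum_all all_conj_distrib Ball_def imp_conjL conj_ac)
  then show ?thesis
    by (simp add: maps_into_def PiE_sum_iff conj_ac)
qed

lemma order_series_poset_sum:
  "order_series (poset_sum r s) = series_sum (order_series r) (order_series s)"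
proof -
  have "bij_betw (\<lambda>k. (k \<circ> Inl, k \<circ> Inr)) (strict_maps (poset_sum r s) n)
      (strict_maps r n \<times> strict_maps s n)" for n
    unfolding strict_maps_eq_maps_into
    by (rule bij_betw_byWitness[where f' = "\<lambda>(g, h). case_sum g h"])
      (auto simp: maps_into_poset_sum_iff)
  from bij_betw_same_card[OF this]
  have "card (strict_maps (poset_sum r s) n) = card (strict_maps r n) * card (strict_maps s n)" for n
    by (simp add: card_cartesian_product)
  then show ?thesis
    by (intro fps_ext) (simp add: order_series_def series_sum_def)
qed

text \<open>Translation by \<open>j\<close> is the bijection; the truncated subtraction is exact
  because all values exceed \<open>j\<close>.\<close>

lemma card_maps_into_shift:
  "card (maps_into s {Suc j..j + m}) = card (strict_maps s m)"
proof -
  let ?F = "\<lambda>h. restrict (\<lambda>b. h b - j) (Field s)"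
  let ?G = "\<lambda>h. restrict (\<lambda>b. h b + j) (Field s)"
  have "bij_betw ?F (maps_into s {Suc j..j + m}) (strict_maps s m)"
  proof (rule bij_betw_byWitness[where f' = ?G]; (intro ballI subsetI)?)
    fix h assume h: "h \<in> maps_into s {Suc j..j + m}"
    then have "\<And>b. b \<in> Field s \<Longrightarrow> Suc j \<le> h b \<and> h b \<le> j + m" "h \<in> extensional (Field s)"
      by (auto simp: maps_into_def PiE_iff)
    then show "?G (?F h) = h"
      by (force simp: fun_eq_iff extensional_def)
  next
    fix h assume "h \<in> strict_maps s m"
    then show "?F (?G h) = h"
      by (auto simp: fun_eq_iff extensional_def strict_maps_def PiE_iff)
  next
    fix k assume "k \<in> ?F ` maps_into s {Suc j..j + m}"
    then obtain h where h: "h \<in> maps_into s {Suc j..j + m}" and k: "k = ?F h" by blast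
    then have b: "\<And>b. b \<in> Field s \<Longrightarrow> Suc j \<le> h b \<and> h b \<le> j + m"
      by (auto simp: maps_into_def PiE_iff)
    have "k a < k b" if "(a, b) \<in> s" "a \<noteq> b" for a b
    proof -
      have "a \<in> Field s" "b \<in> Field s" "h a < h b"
        using that h by (auto simp: maps_into_def intro: FieldI1 FieldI2)
      then show ?thesis using b[of a] b[of b] unfolding k by auto
    qed
    moreover have "k \<in> Field s \<rightarrow>\<^sub>E {1..m}"
      unfolding k using b by fastforce
    ultimately show "k \<in> strict_maps s m" by (auto simp: strict_maps_def)
  next
    fix k assume "k \<in> ?G ` strict_maps s m"
    then obtain h where h: "h \<in> strict_maps s m" and k: "k = ?G h" by blast
    have "k a < k b" if "(a, b) \<in> s" "a \<noteq> b" for a b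
    proof -
      have "a \<in> Field s" "b \<in> Field s" "h a < h b"
        using that h by (auto simp: strict_maps_def intro: FieldI1 FieldI2)
      then show ?thesis unfolding k by auto
    qed
    moreover have "k \<in> Field s \<rightarrow>\<^sub>E {Suc j..j + m}"
      unfolding k using h by (fastforce simp: strict_maps_def PiE_iff)
    ultimately show "k \<in> maps_into s {Suc j..j + m}" by (auto simp: maps_into_def)
  qed
  then show ?thesis by (rule bij_betw_same_card)
qed

lemma strict_maps_mono: "m \<le> n \<Longrightarrow> strict_maps r m \<subseteq> strict_maps r n"
  by (auto simp: strict_maps_def PiE_iff)

text \<open>A strict map on a concatenation is cut at the largest value \<open>j\<close> taken on the lower part.\<close>

lemma card_strict_maps_poset_concat:
  assumes fin: "finite (Field r)" "finite (Field s)" and ne: "Field r \<noteq> {}"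
  shows "card (strict_maps (poset_concat r s) n) =
    (\<Sum>j = 1..n. (card (strict_maps r j) - card (strict_maps r (j - 1))) * card (strict_maps s (n - j)))"
proof -
  \<comment> \<open>The maps whose largest value is exactly \<open>j\<close>, written as a
    difference so that their number becomes a coefficient of \<open>(1 - x)\<close> times the
    series.\<close>
  define M where "M j = strict_maps r j - strict_maps r (j - 1)" for j
  define S where "S = (SIGMA j:{1..n}. M j \<times> maps_into s {Suc j..n})"
  have M_iff: "g \<in> M j \<longleftrightarrow> g \<in> maps_into r {1..j} \<and> Max (g ` Field r) = j" for g j
  proof -
    have "g \<in> maps_into r {1..j - 1} \<longleftrightarrow> Max (g ` Field r) \<noteq> j" if g: "g \<in> maps_into r {1..j}"
    proof -
      have b: "\<And>a. a \<in> Field r \<Longrightarrow> 1 \<le> g a \<and> g a \<le> j"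
        using g by (auto simp: maps_into_def PiE_iff)
      have "Max (g ` Field r) = j \<longleftrightarrow> j \<in> g ` Field r"
        using fin ne b by (auto simp: Max_eq_iff)
      also have "\<dots> \<longleftrightarrow> \<not> (\<forall>a\<in>Field r. g a \<le> j - 1)"
      proof -
        have "g a = j \<longleftrightarrow> \<not> g a \<le> j - 1" if "a \<in> Field r" for a
          using b[OF that] by linarith
        then show ?thesis by blast
      qed
      also have "\<dots> \<longleftrightarrow> g \<notin> maps_into r {1..j - 1}"
        using g by (auto simp: maps_into_def PiE_iff)
      finally show ?thesis by blast
    qed
    then show ?thesis by (auto simp: M_def strict_maps_eq_maps_into)
  qed
  have "bij_betw (\<lambda>k. (Max ((k \<circ> Inl) ` Field r), k \<circ> Inl, k \<circ> Inr)) (strict_maps (poset_concat r s) n) S"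
  proof (rule bij_betw_byWitness[where f' = "\<lambda>(j, g, h). case_sum g h"])
    show "\<forall>k\<in>strict_maps (poset_concat r s) n.
        (\<lambda>(j, g, h). case_sum g h) (Max ((k \<circ> Inl) ` Field r), k \<circ> Inl, k \<circ> Inr) = k"
      by simp
    show "\<forall>x\<in>S. (Max (((\<lambda>(j, g, h). case_sum g h) x \<circ> Inl) ` Field r),
        (\<lambda>(j, g, h). case_sum g h) x \<circ> Inl, (\<lambda>(j, g, h). case_sum g h) x \<circ> Inr) = x"
      by (auto simp: S_def M_iff)
    show "(\<lambda>k. (Max ((k \<circ> Inl) ` Field r), k \<circ> Inl, k \<circ> Inr)) ` strict_maps (poset_concat r s) n \<subseteq> S"
    proof (rule image_subsetI)
      fix k assume k: "k \<in> strict_maps (poset_concat r s) n"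
      let ?j = "Max ((k \<circ> Inl) ` Field r)"
      from k have kl: "k \<circ> Inl \<in> maps_into r {1..n}" and kr: "k \<circ> Inr \<in> maps_into s {1..n}"
        and lt: "\<And>a b. a \<in> Field r \<Longrightarrow> b \<in> Field s \<Longrightarrow> k (Inl a) < k (Inr b)"
        by (auto simp: strict_maps_eq_maps_into maps_into_poset_concat_iff)
      have "?j \<in> (k \<circ> Inl) ` Field r" by (rule Max_in) (use fin ne in auto)
      then obtain a where a: "a \<in> Field r" "?j = k (Inl a)" by auto
      have le: "\<And>b. b \<in> Field r \<Longrightarrow> k (Inl b) \<le> ?j"
        using fin by (auto intro!: Max_ge)
      have j: "?j \<in> {1..n}" using kl a by (auto simp: maps_into_def PiE_iff)
      have "k \<circ> Inl \<in> maps_into r {1..?j}" using kl le by (auto simp: maps_into_def PiE_iff)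
      then have "k \<circ> Inl \<in> M ?j" by (simp only: M_iff simp_thms)
      moreover have "k \<circ> Inr \<in> maps_into s {Suc ?j..n}"
        using kr lt[OF a(1)] a(2) by (auto simp: maps_into_def PiE_iff Suc_le_eq)
      ultimately show "(?j, k \<circ> Inl, k \<circ> Inr) \<in> S"
        using j unfolding S_def by blast
    qed
    show "(\<lambda>(j, g, h). case_sum g h) ` S \<subseteq> strict_maps (poset_concat r s) n"
    proof (rule image_subsetI)
      fix x assume "x \<in> S"
      then obtain j g h where x: "x = (j, g, h)" and j: "j \<in> {1..n}"
        and g: "g \<in> maps_into r {1..j}" and h: "h \<in> maps_into s {Suc j..n}"
        by (auto simp: S_def M_iff)
      have "g a < h b" if "a \<in> Field r" "b \<in> Field s" for a b
        using that g h by (fastforce simp: maps_into_def PiE_iff)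
      moreover have "g \<in> maps_into r {1..n}" "h \<in> maps_into s {1..n}"
        using g h j by (force simp: maps_into_def PiE_iff)+
      ultimately show "(\<lambda>(j, g, h). case_sum g h) x \<in> strict_maps (poset_concat r s) n"
        unfolding x by (simp add: strict_maps_eq_maps_into maps_into_poset_concat_iff)
    qed
  qed
  then have "card (strict_maps (poset_concat r s) n) = card S"
    by (rule bij_betw_same_card)
  also have "\<dots> = (\<Sum>j = 1..n. card (M j) * card (maps_into s {Suc j..n}))"
    unfolding S_def using fin
    by (subst card_SigmaI)
      (auto simp: card_cartesian_product M_def strict_maps_eq_maps_into finite_maps_into)
  also have "\<dots> = (\<Sum>j = 1..n. (card (strict_maps r j) - card (strict_maps r (j - 1)))
      * card (strict_maps s (n - j)))"
  proof (rule sum.cong)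
    fix j assume j: "j \<in> {1..n}"
    have "strict_maps r (j - 1) \<subseteq> strict_maps r j"
      by (rule strict_maps_mono) simp
    then have "card (M j) = card (strict_maps r j) - card (strict_maps r (j - 1))"
      unfolding M_def using fin
      by (simp add: card_Diff_subset strict_maps_eq_maps_into finite_maps_into)
    moreover have "card (maps_into s {Suc j..n}) = card (strict_maps s (n - j))"
      using card_maps_into_shift[of s j "n - j"] j by simp
    ultimately show "card (M j) * card (maps_into s {Suc j..n}) =
        (card (strict_maps r j) - card (strict_maps r (j - 1))) * card (strict_maps s (n - j))"
      by simp
  qed simp
  finally show ?thesis .
qed

lemma strict_maps_0: "Field r \<noteq> {} \<Longrightarrow> strict_maps r 0 = {}"
  by (auto simp: strict_maps_def PiE_iff)

lemma nth_order_series: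
  assumes "Field r \<noteq> {}"
  shows "fps_nth (order_series r) n = int (card (strict_maps r n))"
  using assms by (simp add: order_series_def strict_maps_0)

text \<open>The factor \<open>1 - x\<close> produces the differences that count maps with a
  prescribed largest value, and the Cauchy product sums over the cut. Nonemptiness matters: the
  series of the empty poset is \<open>x/(1 - x)\<close>, for which the formula would give an extra
  factor \<open>x\<close>.\<close>

lemma order_series_poset_concat:
  assumes fin: "finite (Field r)" "finite (Field s)" and ne: "Field r \<noteq> {}" "Field s \<noteq> {}"
  shows "order_series (poset_concat r s) = series_concat (order_series r) (order_series s)"
proof (rule fps_ext)
  fix n
  \<comment> \<open>Makes the truncated difference of natural numbers agree with the integer
    one.\<close>
  have mono: "card (strict_maps r (j - 1)) \<le> card (strict_maps r j)" for j
    using fin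
    by (intro card_mono strict_maps_mono) (simp_all add: strict_maps_eq_maps_into finite_maps_into)
  have z: "card (strict_maps r 0) = 0"
    using ne by (simp add: strict_maps_0)
  have d: "fps_nth ((1 - fps_X) * order_series r) j
      = int (card (strict_maps r j) - card (strict_maps r (j - 1)))" for j
    using mono[of j] z ne by (cases j) (auto simp: left_diff_distrib nth_order_series)
  have "fps_nth (order_series (poset_concat r s)) n
      = (\<Sum>j = 1..n. int (card (strict_maps r j) - card (strict_maps r (j - 1)))
          * int (card (strict_maps s (n - j))))"
    using fin ne by (simp add: nth_order_series card_strict_maps_poset_concat)
  \<comment> \<open>The Cauchy product starts at \<open>j = 0\<close>; this term vanishes, since a
    nonempty poset has no map into an empty set of values.\<close>
  also have "\<dots> = (\<Sum>j = 0..n. fps_nth ((1 - fps_X) * order_series r) j * fps_nth (order_series s) (n - j))"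
    unfolding d nth_order_series[OF ne(2)] using z
    by (simp add: sum.atLeast_Suc_atMost[of 0 n])
  also have "\<dots> = fps_nth (series_concat (order_series r) (order_series s)) n"
    by (simp add: series_concat_def fps_mult_nth)
  finally show "fps_nth (order_series (poset_concat r s)) n =
    fps_nth (series_concat (order_series r) (order_series s)) n" .
qed

lemma nth_zeta_1: "fps_nth (zeta 1) n = int n"
proof -
  have "strict_maps (chain_poset 1) n = {1} \<rightarrow>\<^sub>E {1..n}"
    unfolding strict_maps_def Field_chain_poset by (auto simp: chain_poset_def)
  then show ?thesis
    by (simp add: zeta_def order_series_def card_PiE)
qed

text \<open>Adding a top point is a concatenation. Hence the closed form of \<open>zeta\<close>
  follows from \<open>zeta 1\<close> alone, without counting subsets.\<close>

lemma zeta_Suc: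
  assumes "1 \<le> n"
  shows "zeta (Suc n) = series_concat (zeta n) (zeta 1)"
proof -
  let ?f = "case_sum id (\<lambda>_. Suc n) :: nat + nat \<Rightarrow> nat"
  have "chain_poset (Suc n) = dir_image (poset_concat (chain_poset n) (chain_poset 1)) ?f"
  proof -
    have "\<And>a b. (a, b) \<in> chain_poset (Suc n) \<longleftrightarrow>
        (a, b) \<in> chain_poset n \<or> a \<in> {1..n} \<and> b = Suc n \<or> a = Suc n \<and> b = Suc n"
      using assms unfolding chain_poset_def by auto
    moreover have "\<And>a b. (a, b) \<in> chain_poset 1 \<longleftrightarrow> a = 1 \<and> b = 1"
      unfolding chain_poset_def by auto
    ultimately have "(a, b) \<in> chain_poset (Suc n) \<longleftrightarrow>
        (\<exists>x y. a = ?f x \<and> b = ?f y \<and> (x, y) \<in> poset_concat (chain_poset n) (chain_poset 1))" for a b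
      by (simp add: split_sum_ex conj_ac)
    then show ?thesis by (auto simp: dir_image_def)
  qed
  moreover have "inj_on ?f (Field (poset_concat (chain_poset n) (chain_poset 1)))"
    by (auto simp: inj_on_def)
  ultimately show ?thesis
    using assms by (simp add: zeta_def order_series_dir_image order_series_poset_concat)
qed

section \<open>Chains, covers and components\<close>

definition minimals :: "'a rel \<Rightarrow> 'a set" where
  "minimals r = {a \<in> Field r. \<forall>b. (b, a) \<in> r \<longrightarrow> b = a}"

definition maximals :: "'a rel \<Rightarrow> 'a set" where
  "maximals r = {a \<in> Field r. \<forall>b. (a, b) \<in> r \<longrightarrow> b = a}"

lemma minimals_poset_sum: "minimals (poset_sum r s) = Inl ` minimals r \<union> Inr ` minimals s"
  by (rule set_eqI, case_tac x) (simp_all add: minimals_def split_sum_all image_iff)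

lemma maximals_poset_sum: "maximals (poset_sum r s) = Inl ` maximals r \<union> Inr ` maximals s"
  by (rule set_eqI, case_tac x) (simp_all add: maximals_def split_sum_all image_iff)

lemma minimals_poset_concat:
  "Field r \<noteq> {} \<Longrightarrow> minimals (poset_concat r s) = Inl ` minimals r"
  by (rule set_eqI, case_tac x) (auto simp add: minimals_def split_sum_all image_iff)

lemma maximals_poset_concat:
  "Field s \<noteq> {} \<Longrightarrow> maximals (poset_concat r s) = Inr ` maximals s"
  by (rule set_eqI, case_tac x) (auto simp add: maximals_def split_sum_all image_iff)

lemma covers_poset_sum:
  "covers (poset_sum r s) = map_prod Inl Inl ` covers r \<union> map_prod Inr Inr ` covers s"
proof (rule set_eqI)
  fix z :: "('a + 'b) \<times> ('a + 'b)"
  obtain x y where z: "z = (x, y)" by (rule prod.exhaust)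
  show "z \<in> covers (poset_sum r s) \<longleftrightarrow> z \<in> map_prod Inl Inl ` covers r \<union> map_prod Inr Inr ` covers s"
    unfolding z by (cases x; cases y) (simp_all add: covers_def split_sum_ex image_iff)
qed

text \<open>A pair across the cut has nothing in between exactly when the lower point is maximal in
  \<open>r\<close> and the upper one minimal in \<open>s\<close>. This is why minimal and maximal
  elements are tracked at all.\<close>

lemma covers_poset_concat:
  "covers (poset_concat r s) = map_prod Inl Inl ` covers r \<union> map_prod Inr Inr ` covers s
    \<union> Inl ` maximals r \<times> Inr ` minimals s"
proof (rule set_eqI)
  fix z :: "('a + 'b) \<times> ('a + 'b)"
  obtain x y where z: "z = (x, y)" by (rule prod.exhaust)
  have 1: "a \<in> maximals r \<longleftrightarrow> a \<in> Field r \<and> \<not> (\<exists>c. c \<noteq> a \<and> (a, c) \<in> r \<and> c \<in> Field r)" for a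
    by (auto simp: maximals_def intro: FieldI2)
  have 2: "a \<in> minimals s \<longleftrightarrow> a \<in> Field s \<and> \<not> (\<exists>c. c \<noteq> a \<and> c \<in> Field s \<and> (c, a) \<in> s)" for a
    by (auto simp: minimals_def intro: FieldI1)
  show "z \<in> covers (poset_concat r s) \<longleftrightarrow> z \<in> map_prod Inl Inl ` covers r \<union> map_prod Inr Inr ` covers s
    \<union> Inl ` maximals r \<times> Inr ` minimals s"
    unfolding z by (cases x; cases y) (auto simp: covers_def split_sum_ex image_iff 1 2)
qed

lemma card_Field_poset_sum_concat:
  assumes "finite (Field r)" "finite (Field s)"
  shows "card (Field (poset_sum r s)) = card (Field r) + card (Field s)"
    and "card (Field (poset_concat r s)) = card (Field r) + card (Field s)"
proof -
  have "card (Inl ` Field r \<union> Inr ` Field s) = card (Field r) + card (Field s)"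
    using assms by (subst card_Un_disjoint) (auto simp: card_image)
  then show "card (Field (poset_sum r s)) = card (Field r) + card (Field s)"
    "card (Field (poset_concat r s)) = card (Field r) + card (Field s)"
    unfolding Field_poset_sum Field_poset_concat by simp_all
qed

lemma finite_covers: "finite (Field r) \<Longrightarrow> finite (covers r)"
  by (rule finite_subset[of _ "Field r \<times> Field r"]) (auto simp: covers_def intro: FieldI1 FieldI2)

lemma card_map_prod_image:
  "inj f \<Longrightarrow> card (map_prod f f ` A) = card A"
  by (rule card_image) (auto simp: inj_on_def)

lemma card_covers_poset_sum:
  assumes "finite (Field r)" "finite (Field s)"
  shows "card (covers (poset_sum r s)) = card (covers r) + card (covers s)"
  unfolding covers_poset_sum using assms
  by (subst card_Un_disjoint) (auto simp: finite_covers card_map_prod_image)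

lemma card_covers_poset_concat:
  assumes "finite (Field r)" "finite (Field s)"
  shows "card (covers (poset_concat r s)) =
    card (covers r) + card (covers s) + card (maximals r) * card (minimals s)"
proof -
  have "finite (maximals r)" "finite (minimals s)"
    using assms by (auto simp: maximals_def minimals_def)
  then show ?thesis
    unfolding covers_poset_concat using assms
    by (subst card_Un_disjoint; (subst card_Un_disjoint)?)
      (auto simp: finite_covers card_map_prod_image card_image card_cartesian_product)
qed

lemma minimals_dir_image:
  assumes inj: "inj_on f (Field r)"
  shows "minimals (dir_image r f) = f ` minimals r"
proof -
  have "(\<forall>y. (y, f a) \<in> dir_image r f \<longrightarrow> y = f a) \<longleftrightarrow> (\<forall>b. (b, a) \<in> r \<longrightarrow> b = a)"
    if "a \<in> Field r" for a
    using that inj unfolding dir_image_def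
    by simp (metis FieldI1 FieldI2 inj_onD)
  then show ?thesis
    unfolding minimals_def dir_image_Field by blast
qed

lemma maximals_dir_image:
  assumes inj: "inj_on f (Field r)"
  shows "maximals (dir_image r f) = f ` maximals r"
proof -
  have "(\<forall>y. (f a, y) \<in> dir_image r f \<longrightarrow> y = f a) \<longleftrightarrow> (\<forall>b. (a, b) \<in> r \<longrightarrow> b = a)"
    if "a \<in> Field r" for a
    using that inj unfolding dir_image_def
    by simp (metis FieldI1 FieldI2 inj_onD)
  then show ?thesis
    unfolding maximals_def dir_image_Field by blast
qed

lemma card_minimals_dir_image:
  "inj_on f (Field r) \<Longrightarrow> card (minimals (dir_image r f)) = card (minimals r)"
  by (subst minimals_dir_image)
    (auto simp: minimals_def intro!: card_image elim: inj_on_subset)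

lemma card_maximals_dir_image:
  "inj_on f (Field r) \<Longrightarrow> card (maximals (dir_image r f)) = card (maximals r)"
  by (subst maximals_dir_image)
    (auto simp: maximals_def intro!: card_image elim: inj_on_subset)

lemma card_covers_dir_image:
  assumes inj: "inj_on f (Field r)"
  shows "card (covers (dir_image r f)) = card (covers r)"
proof -
  have sub: "covers r \<subseteq> Field r \<times> Field r"
    by (auto simp: covers_def intro: FieldI1 FieldI2)
  have iff: "(f a, f b) \<in> covers (dir_image r f) \<longleftrightarrow> (a, b) \<in> covers r"
    if ab: "a \<in> Field r" "b \<in> Field r" for a b
  proof -
    \<comment> \<open>Points between two images are themselves images, so betweenness can be pulled
      back along \<open>f\<close>.\<close>
    have "(\<exists>z. z \<noteq> f a \<and> z \<noteq> f b \<and> (f a, z) \<in> dir_image r f \<and> (z, f b) \<in> dir_image r f) \<longleftrightarrow>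
        (\<exists>c\<in>Field r. f c \<noteq> f a \<and> f c \<noteq> f b \<and> (f a, f c) \<in> dir_image r f \<and> (f c, f b) \<in> dir_image r f)"
    proof -
      have "\<And>z. (f a, z) \<in> dir_image r f \<Longrightarrow> z \<in> f ` Field r"
        using dir_image_Field by (metis FieldI2)
      then show ?thesis by blast
    qed
    also have "\<dots> \<longleftrightarrow> (\<exists>c\<in>Field r. c \<noteq> a \<and> c \<noteq> b \<and> (a, c) \<in> r \<and> (c, b) \<in> r)"
      using ab by (intro bex_cong refl) (simp add: mem_dir_image_iff[OF inj] inj_on_eq_iff[OF inj])
    also have "\<dots> \<longleftrightarrow> (\<exists>c. c \<noteq> a \<and> c \<noteq> b \<and> (a, c) \<in> r \<and> (c, b) \<in> r)"
      by (blast intro: FieldI1)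
    finally show ?thesis
      by (simp only: covers_def mem_Collect_eq case_prod_conv mem_dir_image_iff[OF inj ab]
          inj_on_eq_iff[OF inj ab])
  qed
  have "covers (dir_image r f) = map_prod f f ` covers r"
  proof (intro set_eqI iffI)
    fix z assume z: "z \<in> covers (dir_image r f)"
    then obtain a b where "z = (f a, f b)" "(a, b) \<in> r"
      by (auto simp: covers_def dir_image_def)
    moreover from this have "a \<in> Field r" "b \<in> Field r" by (blast intro: FieldI1 FieldI2)+
    ultimately have "(a, b) \<in> covers r" "z = map_prod f f (a, b)"
      using iff z by simp_all
    then show "z \<in> map_prod f f ` covers r" by (rule rev_image_eqI)
  next
    fix z assume "z \<in> map_prod f f ` covers r"
    then obtain a b where "z = (f a, f b)" "(a, b) \<in> covers r" by auto
    moreover from this have "a \<in> Field r" "b \<in> Field r" using sub by auto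
    ultimately show "z \<in> covers (dir_image r f)" using iff by simp
  qed
  moreover have "inj_on (map_prod f f) (covers r)"
    using map_prod_inj_on[OF inj inj] sub by (rule inj_on_subset)
  ultimately show ?thesis by (simp add: card_image)
qed

section \<open>Longest chains\<close>

text \<open>A witness and a bound pass through the constructions more easily than a
  \<open>Max\<close>; the two forms are matched in \<open>max_chain_card_eq\<close>.\<close>

definition longest_chain :: "'a rel \<Rightarrow> nat \<Rightarrow> bool" where
  "longest_chain r n \<longleftrightarrow> (\<exists>C\<in>Chains r. card C = n) \<and> (\<forall>C\<in>Chains r. card C \<le> n)"

lemma Chains_subset_Field: "C \<in> Chains r \<Longrightarrow> C \<subseteq> Field r"
  by (auto simp: Chains_def intro: FieldI1)

lemma max_chain_card_eq:
  assumes "finite (Field r)" "longest_chain r n"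
  shows "max_chain_card r = n"
proof -
  have "Chains r \<subseteq> Pow (Field r)" using Chains_subset_Field by blast
  then have "finite (Chains r)"
    using assms(1) by (simp add: finite_subset)
  then show ?thesis
    using assms(2) unfolding max_chain_card_def longest_chain_def
    by (intro Max_eqI) auto
qed

lemma longest_chain_dir_image:
  assumes inj: "inj_on f (Field r)" and l: "longest_chain r n"
  shows "longest_chain (dir_image r f) n"
proof -
  have *: "Chains (dir_image r f) = (`) f ` Chains r"
  proof (intro set_eqI iffI)
    fix C assume C: "C \<in> Chains (dir_image r f)"
    then have "C \<subseteq> f ` Field r"
      using Chains_subset_Field dir_image_Field by metis
    then obtain A where A: "A \<subseteq> Field r" "C = f ` A"
      by (meson subset_image_iff)
    then have "A \<in> Chains r"
      using C inj unfolding Chains_def by (auto simp: mem_dir_image_iff subset_iff)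
    with A show "C \<in> (`) f ` Chains r" by blast
  next
    fix C assume "C \<in> (`) f ` Chains r"
    moreover have "(a, b) \<in> r \<Longrightarrow> (f a, f b) \<in> dir_image r f" for a b
      by (auto simp: dir_image_def)
    ultimately show "C \<in> Chains (dir_image r f)"
      unfolding Chains_def by blast
  qed
  moreover have "card (f ` C) = card C" if "C \<in> Chains r" for C
    using Chains_subset_Field[OF that] inj by (metis card_image inj_on_subset)
  ultimately show ?thesis
    using l by (auto simp: longest_chain_def)
qed

text \<open>The chains of the concatenation are the unions of an arbitrary chain of \<open>r\<close>
  and an arbitrary chain of \<open>s\<close>.\<close>

lemma longest_chain_poset_concat:
  assumes fin: "finite (Field r)" "finite (Field s)"
    and r: "longest_chain r m" and s: "longest_chain s n"
  shows "longest_chain (poset_concat r s) (m + n)"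
proof -
  have card: "card (A <+> B) = card A + card B" if "A \<in> Chains r" "B \<in> Chains s" for A B
    using that fin Chains_subset_Field by (metis card_Plus finite_subset)
  have split: "\<exists>A\<in>Chains r. \<exists>B\<in>Chains s. C = A <+> B" if "C \<in> Chains (poset_concat r s)" for C
  proof (intro bexI)
    show "C = Inl -` C <+> Inr -` C"
      by (rule set_eqI, case_tac x) auto
    show "Inl -` C \<in> Chains r" "Inr -` C \<in> Chains s"
      using that by (fastforce simp: Chains_def)+
  qed
  have join: "A <+> B \<in> Chains (poset_concat r s)" if "A \<in> Chains r" "B \<in> Chains s" for A B
  proof -
    have "x \<in> Field r" "y \<in> Field s" if "x \<in> A" "y \<in> B" for x y
      using \<open>A \<in> Chains r\<close> \<open>B \<in> Chains s\<close> that Chains_subset_Field by blast+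
    then show ?thesis
      using that unfolding Chains_def by (simp add: Plus_def ball_Un)
  qed
  show ?thesis
    unfolding longest_chain_def
  proof (intro conjI ballI)
    obtain A B where "A \<in> Chains r" "card A = m" "B \<in> Chains s" "card B = n"
      using r s by (auto simp: longest_chain_def)
    with join card show "\<exists>C\<in>Chains (poset_concat r s). card C = m + n" by blast
    fix C assume "C \<in> Chains (poset_concat r s)"
    then obtain A B where "A \<in> Chains r" "B \<in> Chains s" "C = A <+> B"
      using split by blast
    then show "card C \<le> m + n"
      using card r s by (simp add: longest_chain_def add_mono)
  qed
qed

text \<open>The two parts are incomparable, so a chain lies entirely in one of them.\<close>

lemma longest_chain_poset_sum:
  assumes r: "longest_chain r m" and s: "longest_chain s n"
  shows "longest_chain (poset_sum r s) (max m n)"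
proof -
  have split: "(\<exists>A\<in>Chains r. C = Inl ` A) \<or> (\<exists>B\<in>Chains s. C = Inr ` B)"
    if C: "C \<in> Chains (poset_sum r s)" for C
  proof (cases "\<exists>a. Inl a \<in> C")
    case True
    then have "C = Inl ` (Inl -` C)"
      using C unfolding Chains_def
      by (intro set_eqI, case_tac x) (auto, metis poset_sum_iff(3,4))
    moreover have "Inl -` C \<in> Chains r" using C by (fastforce simp: Chains_def)
    ultimately show ?thesis by blast
  next
    case False
    then have "C = Inr ` (Inr -` C)"
      by (intro set_eqI, case_tac x) auto
    moreover have "Inr -` C \<in> Chains s" using C by (fastforce simp: Chains_def)
    ultimately show ?thesis by blast
  qed
  have join: "A \<in> Chains r \<Longrightarrow> Inl ` A \<in> Chains (poset_sum r s)"
    "B \<in> Chains s \<Longrightarrow> Inr ` B \<in> Chains (poset_sum r s)" for A B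
    by (auto simp: Chains_def)
  have card: "card (Inl ` A) = card A" "card (Inr ` B) = card B"
    for A :: "'a set" and B :: "'b set"
    by (auto intro: card_image)
  show ?thesis
    unfolding longest_chain_def
  proof (intro conjI ballI)
    show "\<exists>C\<in>Chains (poset_sum r s). card C = max m n"
      using r s join card unfolding longest_chain_def max_def by metis
    fix C assume "C \<in> Chains (poset_sum r s)"
    from split[OF this] show "card C \<le> max m n"
      using r s by (auto simp: longest_chain_def card le_max_iff_disj)
  qed
qed

section \<open>Connectedness and edges of the Hasse diagram\<close>

text \<open>Descent along covers, by induction on the size of the principal down-set. Strictly below
  a nonminimal \<open>a\<close>, take \<open>e\<close> with the largest down-set; a point strictly
  between would have a larger one, so \<open>a\<close> covers \<open>e\<close>.\<close>

lemma minimal_covers_rtrancl: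
  assumes po: "Partial_order r" and fin: "finite r" and a: "a \<in> Field r"
  shows "\<exists>m\<in>minimals r. (m, a) \<in> (covers r)\<^sup>*"
proof -
  let ?d = "\<lambda>a. {c. (c, a) \<in> r}"
  have rf: "\<And>a. a \<in> Field r \<Longrightarrow> (a, a) \<in> r" and tr: "trans r" and as: "antisym r"
    using po by (auto simp: order_on_defs refl_on_def)
  have find: "finite (?d a)" for a
    by (rule finite_subset[of _ "Domain r"]) (auto simp: fin finite_Domain)
  have mono: "card (?d b) < card (?d a)" if "(b, a) \<in> r" "b \<noteq> a" for a b
  proof (rule psubset_card_mono[OF find])
    have "?d b \<subseteq> ?d a" using that tr by (auto dest: transD)
    moreover have "a \<in> ?d a" using that rf by (auto intro: FieldI2)
    moreover have "a \<notin> ?d b" using that as by (auto dest: antisymD)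
    ultimately show "?d b \<subset> ?d a" by blast
  qed
  show ?thesis
    using a
  proof (induction "card (?d a)" arbitrary: a rule: less_induct)
    case less
    show ?case
    proof (cases "a \<in> minimals r")
      case False
      then obtain b where b: "(b, a) \<in> r" "b \<noteq> a"
        using less.prems by (auto simp: minimals_def)
      define B where "B = {b. (b, a) \<in> r \<and> b \<noteq> a}"
      have B: "finite B" "B \<noteq> {}"
        using b finite_subset[OF _ find[of a], of B] by (auto simp: B_def)
      have "Max ((\<lambda>b. card (?d b)) ` B) \<in> (\<lambda>b. card (?d b)) ` B"
        using B by (intro Max_in) auto
      then obtain e where e: "e \<in> B" "Max ((\<lambda>b. card (?d b)) ` B) = card (?d e)"
        by blast
      have le: "card (?d b) \<le> card (?d e)" if "b \<in> B" for b
        unfolding e(2)[symmetric] using B that by (intro Max_ge) auto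
      have "(e, a) \<in> covers r"
      proof -
        have "False" if c: "c \<noteq> e" "c \<noteq> a" "(e, c) \<in> r" "(c, a) \<in> r" for c
        proof -
          have "card (?d e) < card (?d c)" using mono[of e c] c by simp
          moreover have "c \<in> B" using c by (simp add: B_def)
          ultimately show False using le[of c] by simp
        qed
        then show ?thesis using e(1) by (auto simp: covers_def B_def)
      qed
      moreover have "\<exists>m\<in>minimals r. (m, e) \<in> (covers r)\<^sup>*"
      proof (rule less.hyps)
        show "card (?d e) < card (?d a)" using mono[of e a] e(1) by (simp add: B_def)
        show "e \<in> Field r" using e(1) by (auto simp: B_def intro: FieldI1)
      qed
      ultimately show ?thesis by (meson rtrancl.rtrancl_into_rtrancl)
    qed auto
  qed
qed

text \<open>By antisymmetry an undirected edge comes from only one of its two orientations.\<close>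

lemma card_hasse_edges:
  assumes "antisym r"
  shows "card (hasse_edges r) = card (covers r)"
proof -
  have "hasse_edges r = (\<lambda>(a, b). {a, b}) ` covers r"
    by (auto simp: hasse_edges_def)
  moreover have "inj_on (\<lambda>(a, b). {a, b}) (covers r)"
    using assms by (auto simp: inj_on_def covers_def doubleton_eq_iff dest: antisymD)
  ultimately show ?thesis by (simp add: card_image)
qed

lemma card_components_hasse_edges:
  assumes po: "Partial_order r" and fin: "finite r" and one: "card (minimals r) = 1"
  shows "card (components (Field r) (hasse_edges r)) = 1"
proof -
  let ?E = "{(x, y). {x, y} \<in> hasse_edges r}"
  obtain m where m: "minimals r = {m}" using one card_1_singletonE by blast
  have sub: "covers r \<subseteq> ?E" by (auto simp: hasse_edges_def)
  have "sym ?E" by (auto simp: sym_def insert_commute)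
  then have sym: "sym (?E\<^sup>*)" by (rule sym_rtrancl)
  have "(m, a) \<in> ?E\<^sup>*" if "a \<in> Field r" for a
    using minimal_covers_rtrancl[OF po fin that] rtrancl_mono[OF sub] m by auto
  then have "(a, b) \<in> ?E\<^sup>*" if "a \<in> Field r" "b \<in> Field r" for a b
    using that sym by (meson rtrancl_trans symD)
  then have "{(a, b) \<in> Field r \<times> Field r. (a, b) \<in> ?E\<^sup>*} = Field r \<times> Field r"
    by auto
  moreover have "m \<in> Field r" using m by (auto simp: minimals_def)
  then have "Field r // (Field r \<times> Field r) = {Field r}"
    by (auto simp: quotient_def)
  ultimately show ?thesis by (simp add: components_def)
qed

lemma betti_number_hasse:
  assumes "finite_poset r" "card (minimals r) = 1"
  shows "betti_number (Field r) (hasse_edges r) = int (card (covers r)) - int (card (Field r)) + 1"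
  using assms card_components_hasse_edges[of r] card_hasse_edges[of r]
  by (simp add: betti_number_def finite_poset_def order_on_defs)

section \<open>Words\<close>

text \<open>The induction invariant. Covers cannot be counted alone, because concatenation adds
  \<open>card (maximals r) * card (minimals s)\<close> of them; with a single extremal point on each
  side this product is 1.\<close>

definition structure_counts :: "'a rel \<Rightarrow> nat \<Rightarrow> nat \<Rightarrow> nat \<Rightarrow> bool" where
  "structure_counts r l v e \<longleftrightarrow> finite (Field r) \<and> Field r \<noteq> {} \<and> longest_chain r l \<and>
    card (Field r) = v \<and> card (covers r) = e \<and> card (minimals r) = 1 \<and> card (maximals r) = 1"

lemma structure_counts_dir_image:
  assumes "inj_on f (Field r)" "structure_counts r l v e"
  shows "structure_counts (dir_image r f) l v e"
  using assms
  by (simp add: structure_counts_def dir_image_Field card_image longest_chain_dir_image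
      card_covers_dir_image card_minimals_dir_image card_maximals_dir_image)

lemma structure_counts_poset_concat:
  assumes "structure_counts r l v e" "structure_counts s l' v' e'"
  shows "structure_counts (poset_concat r s) (l + l') (v + v') (e + e' + 1)"
proof -
  have "card (Inl ` Field r \<union> Inr ` Field s) = v + v'"
    using assms card_Field_poset_sum_concat(2)[of r s] by (simp add: structure_counts_def)
  then show ?thesis
    using assms
    by (simp add: structure_counts_def longest_chain_poset_concat card_covers_poset_concat
        minimals_poset_concat maximals_poset_concat card_image)
qed

lemma structure_counts_chain_poset_1: "structure_counts (chain_poset 1) 1 1 0"
proof -
  have r: "chain_poset 1 = {(1, 1)}" by (auto simp: chain_poset_def)
  have "Chains {(1::nat, 1::nat)} = {{}, {1}}" by (auto simp: Chains_def)
  then have "longest_chain (chain_poset 1) 1" unfolding r longest_chain_def by simp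
  moreover have "covers (chain_poset 1) = {}" unfolding r covers_def by auto
  moreover have "minimals (chain_poset 1) = {1}" "maximals (chain_poset 1) = {1}"
    unfolding r minimals_def maximals_def by (auto simp: Field_def)
  ultimately show ?thesis by (simp add: structure_counts_def)
qed

text \<open>Beside the new point, the middle part has two minimal and two maximal elements, so
  attaching the maximum and then the minimum costs two covers each.\<close>

lemma structure_counts_poset_D:
  assumes r: "structure_counts r l v e" and "1 \<le> l"
  shows "structure_counts (poset_D r) (l + 2) (v + 3) (e + 4)"
proof -
  let ?c = "chain_poset 1" and ?s = "poset_sum (chain_poset 1) r"
  note c = structure_counts_chain_poset_1
  have fin: "finite (Field ?c)" "finite (Field r)" "finite (Field ?s)"
    using r by (auto simp: structure_counts_def)
  have ne: "Field ?s \<noteq> {}" by simp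
  have V: "card (Field ?s) = v + 1"
    using card_Field_poset_sum_concat(1)[OF fin(1,2)] r by (simp add: structure_counts_def)
  have E: "card (covers ?s) = e"
    using r c by (simp add: card_covers_poset_sum structure_counts_def)
  have m: "card (minimals ?s) = 2"
    unfolding minimals_poset_sum using r c fin
    by (subst card_Un_disjoint) (auto simp: structure_counts_def card_image minimals_def)
  have M: "card (maximals ?s) = 2"
    unfolding maximals_poset_sum using r c fin
    by (subst card_Un_disjoint) (auto simp: structure_counts_def card_image maximals_def)
  \<comment> \<open>The new point contributes only a chain of length 1, and \<open>l\<close> is at
    least 1.\<close>
  have L: "longest_chain ?s l"
    using longest_chain_poset_sum[of ?c 1 r l] r c \<open>1 \<le> l\<close>
    by (simp add: structure_counts_def max_def split: if_splits)
  let ?t = "poset_concat ?s ?c"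
  have "longest_chain ?t (l + 1)"
    using longest_chain_poset_concat[OF fin(3,1) L, of 1] c by (simp add: structure_counts_def)
  moreover have "card (covers ?t) = e + 2"
    using card_covers_poset_concat[OF fin(3,1)] E M c by (simp add: structure_counts_def)
  moreover have "card (Field ?t) = v + 2"
    using card_Field_poset_sum_concat(2)[OF fin(3,1)] unfolding V by simp
  moreover have "card (minimals ?t) = 2" "card (maximals ?t) = 1"
    using c m by (simp_all add: minimals_poset_concat maximals_poset_concat card_image structure_counts_def)
  ultimately have t: "longest_chain ?t (l + 1)" "card (covers ?t) = e + 2" "card (Field ?t) = v + 2"
    "card (minimals ?t) = 2" "card (maximals ?t) = 1" .
  have ft: "finite (Field ?t)" "Field ?t \<noteq> {}" using fin by simp_all
  have "longest_chain (poset_concat ?c ?t) (1 + (l + 1))"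
    using longest_chain_poset_concat[OF fin(1) ft(1) _ t(1), of 1] c by (simp add: structure_counts_def)
  moreover have "card (covers (poset_concat ?c ?t)) = e + 4"
    using card_covers_poset_concat[OF fin(1) ft(1)] t c by (simp add: structure_counts_def)
  moreover have "card (Field (poset_concat ?c ?t)) = v + 3"
    using card_Field_poset_sum_concat(2)[OF fin(1) ft(1)] unfolding t(3) by simp
  moreover have "card (minimals (poset_concat ?c ?t)) = 1" "card (maximals (poset_concat ?c ?t)) = 1"
    using c t ft(2) by (simp_all add: minimals_poset_concat maximals_poset_concat card_image structure_counts_def)
  moreover have "finite (Field (poset_concat ?c ?t))" "Field (poset_concat ?c ?t) \<noteq> {}"
    using ft by simp_all
  ultimately show ?thesis
    unfolding poset_D_def structure_counts_def by simp
qed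

text \<open>The first two counts are the expressions already found for the order and the degree of
  \<open>word_poly w\<close>; this match identifies \<open>i\<close> and \<open>k\<close>.\<close>

lemma structure_counts_eval_word:
  "structure_counts (eval_word w) (1 + count_Conc w + 2 * count_D w)
    (1 + count_Conc w + 3 * count_D w) (count_Conc w + 4 * count_D w)"
proof (induction w)
  case Leaf
  then show ?case using structure_counts_chain_poset_1 by simp
next
  case (D w)
  from structure_counts_dir_image[OF inj_on_to_nat structure_counts_poset_D[OF D]]
  show ?case by (simp add: algebra_simps)
next
  case (Conc v w)
  from structure_counts_dir_image[OF inj_on_to_nat structure_counts_poset_concat[OF Conc]]
  show ?case by (simp add: algebra_simps)
qed

lemma order_series_eval_word: "order_series (eval_word w) = eval_series w"
proof (induction w)
  case Leaf
  then show ?case by (simp add: zeta_def)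
next
  case (D w)
  have "finite (Field (eval_word w))"
    using structure_counts_eval_word by (auto simp: structure_counts_def)
  then have "order_series (poset_D (eval_word w)) = series_D (eval_series w)"
    unfolding poset_D_def series_D_def zeta_def D[symmetric]
    by (subst order_series_poset_concat; (subst order_series_poset_concat)?)
      (simp_all add: order_series_poset_sum)
  then show ?case
    by (simp add: order_series_dir_image inj_on_to_nat)
next
  case (Conc v w)
  then show ?case
    using structure_counts_eval_word[of v] structure_counts_eval_word[of w]
    by (simp add: order_series_dir_image inj_on_to_nat order_series_poset_concat structure_counts_def)
qed

section \<open>Descriptions as polynomials\<close>

lemma zseries_sum: "finite A \<Longrightarrow> zseries (\<Sum>i\<in>A. f i) = (\<Sum>i\<in>A. zseries (f i))"
  by (induction A rule: finite_induct) (simp_all add: zseries_add)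

lemma nth_X_deriv: "fps_nth (fps_X * fps_deriv f) n = of_nat n * fps_nth f n"
  by (cases n) simp_all

lemma zeta_1_eq_zseries: "zeta 1 = zseries [:0, 1:]"
proof (rule fps_ext)
  fix n
  \<comment> \<open>Here \<open>t\<close> is written as \<open>t ((1 + t) 1)'\<close>, so its image
    is \<open>x d/dx\<close> of \<open>1/(1 - x)\<close>, with coefficients
    \<open>n\<close>.\<close>
  have "zseries [:0, 1:] = fps_X * fps_deriv geom"
    using zseries_pderiv[of 1] by (simp add: one_pCons pderiv_pCons zseries_1[unfolded one_pCons])
  then show "fps_nth (zeta 1) n = fps_nth (zseries [:0, 1:]) n"
    by (simp only: nth_X_deriv nth_zeta_1) (simp add: geom_def)
qed

lemma zeta_eq_zseries: "1 \<le> u \<Longrightarrow> zeta u = zseries (monom 1 u)"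
proof (induction u rule: nat_induct_at_least)
  case base
  then show ?case using zeta_1_eq_zseries by (simp add: monom_altdef)
next
  case (Suc u)
  have "monom (1::int) (Suc u) = monom 1 u * [:0, 1:]"
    by (simp add: monom_Suc)
  with Suc show ?case
    using zeta_1_eq_zseries by (simp only: zeta_Suc zseries_mult)
qed

lemma series_D_zseries:
  "series_D (zseries p) = zseries ([:0, 1:] * (([:0, 1:] * pderiv ([:1, 1:] * p)) * [:0, 1:]))"
proof -
  have "series_sum (zeta 1) f = fps_X * fps_deriv f" for f
    by (rule fps_ext) (simp only: nth_X_deriv series_sum_def fps_nth_Abs_fps nth_zeta_1)
  then show ?thesis
    by (simp only: series_D_def zseries_mult zseries_pderiv[symmetric] zeta_1_eq_zseries)
qed

lemma eval_series_eq_zseries: "eval_series w = zseries (word_poly w)"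
  by (induction w)
    (simp_all only: eval_series.simps word_poly.simps zeta_1_eq_zseries series_D_zseries zseries_mult)

text \<open>The bound keeps index 0 out: \<open>zeta 0\<close> is \<open>x/(1 - x)\<close>, whereas
  \<open>t^0\<close> is sent to \<open>1/(1 - x)\<close>.\<close>

lemma zeta_combination_eq_zseries:
  assumes "1 \<le> i"
  shows "(\<Sum>u=i..k. of_nat (d u) * zeta u) = zseries (\<Sum>u=i..k. monom (int (d u)) u)"
proof -
  have "of_nat (d u) * zeta u = zseries (monom (int (d u)) u)" if "u \<in> {i..k}" for u
  proof -
    have "monom (int (d u)) u = smult (int (d u)) (monom 1 u)" by (simp add: smult_monom)
    then show ?thesis
      using that assms by (simp add: zeta_eq_zseries zseries_smult fps_of_nat flip: of_nat_mult)
  qed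
  then show ?thesis
    by (simp add: zseries_sum)
qed

text \<open>Every component of a description becomes an invariant of \<open>p\<close>, which turns
  existence and uniqueness into statements about one polynomial.\<close>

lemma zeta_description_zseries_iff:
  "zeta_description (zseries p) (i, k, d) \<longleftrightarrow>
    p \<noteq> 0 \<and> 1 \<le> i \<and> i = order 0 p \<and> k = degree p \<and> (\<forall>u. coeff p u = int (d u))"
  (is "_ \<longleftrightarrow> ?R")
proof
  assume "zeta_description (zseries p) (i, k, d)"
  then have i: "1 \<le> i" "i \<le> k" "d i \<noteq> 0" "d k \<noteq> 0" and out: "\<And>u. u \<notin> {i..k} \<Longrightarrow> d u = 0"
    and f: "zseries p = (\<Sum>u=i..k. of_nat (d u) * zeta u)"
    unfolding zeta_description_def case_prod_conv by blast+
  have p: "p = (\<Sum>u=i..k. monom (int (d u)) u)"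
    using f zeta_combination_eq_zseries[OF i(1)] by (simp only: zseries_eq_iff)
  have c: "coeff p u = int (d u)" for u
    unfolding p using out[of u] by (simp add: coeff_sum)
  have "degree p = k"
  proof (rule antisym)
    show "degree p \<le> k" by (rule degree_le) (simp add: c out)
    show "k \<le> degree p" by (rule le_degree) (simp add: c i)
  qed
  moreover have "order 0 p = i"
    by (rule order_0_eq_iff) (simp_all add: c i out)
  moreover have "p \<noteq> 0" using c[of i] i(3) by (metis coeff_0 of_nat_eq_0_iff)
  ultimately show ?R
    using i(1) c by simp
next
  assume R: ?R
  then have pz: "p \<noteq> 0" and i: "1 \<le> i" "order 0 p = i" and k: "degree p = k"
    and c: "\<And>u. coeff p u = int (d u)"
    by blast+
  \<comment> \<open>At \<open>i\<close> this gives vanishing below \<open>i\<close>; at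
    \<open>Suc i\<close> it forces \<open>d i\<close> to be nonzero.\<close>
  have low: "n \<le> i \<longleftrightarrow> (\<forall>u<n. d u = 0)" for n
    using monom_1_dvd_iff[OF pz, of n] monom_1_dvd_iff'[of n p] by (simp add: c i(2))
  have di: "d i \<noteq> 0"
    using low[of i] low[of "Suc i"] less_Suc_eq by fastforce
  have out: "d u = 0" if "u \<notin> {i..k}" for u
  proof (cases "u < i")
    case True
    then show ?thesis using low[of i] by simp
  next
    case False
    then have "degree p < u" using that k by simp
    then show ?thesis using c[of u] coeff_eq_0 by fastforce
  qed
  have dk: "d k \<noteq> 0"
    using pz leading_coeff_0_iff[of p] c[of k] k by simp
  have "i \<le> k" using di out[of i] by (meson atLeastAtMost_iff linorder_le_cases)
  moreover have "p = (\<Sum>u=i..k. monom (int (d u)) u)"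
    by (rule poly_eqI) (simp add: coeff_sum c out)
  then have "zseries p = (\<Sum>u=i..k. of_nat (d u) * zeta u)"
    using zeta_combination_eq_zseries[OF i(1)] by (simp only: zseries_eq_iff)
  ultimately show "zeta_description (zseries p) (i, k, d)"
    unfolding zeta_description_def case_prod_conv using i(1) di dk out by blast
qed

text \<open>Splitting the sign as \<open>(-1)^k (-1)^u\<close> turns the sum into
  \<open>(-1)^k p(-1)\<close>, a square of a sign; the vanishing constant coefficient lets the sum
  start at 1.\<close>

lemma alternating_sum_coeffs:
  fixes p :: "int poly"
  assumes "poly p (- 1) = (- 1) ^ degree p" "coeff p 0 = 0"
  shows "(\<Sum>u=1..degree p. (- 1) ^ (degree p - u) * coeff p u) = 1"
proof -
  let ?k = "degree p"
  have sign: "(- 1) ^ (?k - u) = (- 1) ^ ?k * ((- 1) ^ u :: int)" if "u \<le> ?k" for u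
  proof -
    have "(- 1) ^ ?k = (- 1) ^ (?k - u) * ((- 1) ^ u :: int)"
      using that by (simp flip: power_add)
    then show ?thesis by (simp flip: power_mult_distrib)
  qed
  have "(\<Sum>u=1..?k. (- 1) ^ (?k - u) * coeff p u) = (\<Sum>u\<le>?k. (- 1) ^ (?k - u) * coeff p u)"
    by (rule sum.mono_neutral_left) (use assms(2) in \<open>auto simp: not_less_eq_eq Suc_le_eq\<close>)
  also have "\<dots> = (- 1) ^ ?k * poly p (- 1)"
    unfolding poly_altdef sum_distrib_left by (rule sum.cong) (simp_all add: sign)
  also have "\<dots> = 1"
    using assms(1) by (simp flip: power_mult_distrib)
  finally show ?thesis .
qed

theorem theorem3p1:
  fixes X :: "'a rel" and w :: word
  assumes "wixarika X" and "isomorphic (eval_word w) X"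
  shows "order_series X = eval_series w \<and>
    (\<exists>!p. zeta_description (order_series X) p) \<and>
    (\<forall>i k d. zeta_description (order_series X) (i, k, d) \<longrightarrow>
      i = max_chain_card X \<and>
      k = card (Field X) \<and>
      int k - int i = betti_number (Field X) (hasse_edges X) \<and>
      int k - int i = int (count_D w) \<and>
      int i - 2 * (int k - int i) - 1 = int (count_Conc w) \<and>
      (int i - 2 * (int k - int i) - 1) + 1 = int (count_leaves w) \<and>
      (\<Sum>u=1..k. (-1) ^ (k - u) * int (d u)) = 1)"
proof -
  let ?p = "word_poly w"
  obtain f where inj: "inj_on f (Field (eval_word w))" and X: "X = dir_image (eval_word w) f"
    using assms(2) iso_imp_dir_image unfolding isomorphic_def by blast
  have series: "order_series X = eval_series w"
    unfolding X order_series_dir_image[OF inj] by (rule order_series_eval_word)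
  then have series': "order_series X = zseries ?p"
    by (simp add: eval_series_eq_zseries)
  have counts: "structure_counts X (1 + count_Conc w + 2 * count_D w)
    (1 + count_Conc w + 3 * count_D w) (count_Conc w + 4 * count_D w)"
    unfolding X by (rule structure_counts_dir_image[OF inj structure_counts_eval_word])
  then have chain: "max_chain_card X = 1 + count_Conc w + 2 * count_D w"
    by (simp add: max_chain_card_eq structure_counts_def)
  \<comment> \<open>The order axioms behind connectedness come from here;
    \<open>structure_counts\<close> carries only numbers, finiteness and nonemptiness.\<close>
  have "finite_poset X" using assms(1) by (simp add: wixarika_def)
  \<comment> \<open>With \<open>c\<close> and \<open>d\<close> the numbers of \<open>*\<close> and
    \<open>D\<close>, this is \<open>(c + 4 d) - (1 + c + 3 d) + 1 = d\<close>.\<close>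
  then have betti: "betti_number (Field X) (hasse_edges X) = int (count_D w)"
    using counts by (simp add: betti_number_hasse structure_counts_def)
  have leaves: "count_leaves w = count_Conc w + 1" for w
    by (induction w) simp_all
  \<comment> \<open>Since the coefficients are non-negative, \<open>nat\<close> loses
    nothing.\<close>
  have desc: "zeta_description (order_series X) (i, k, d) \<longleftrightarrow>
      i = order 0 ?p \<and> k = degree ?p \<and> d = (\<lambda>u. nat (coeff ?p u))" for i k d
    unfolding series' zeta_description_zseries_iff fun_eq_iff
    using word_poly_nonneg[of w] word_poly_nonzero[of w] order_word_poly[of w]
    by (auto simp: nat_eq_iff2 eq_nat_nat_iff)
  have unique: "\<exists>!p. zeta_description (order_series X) p"
    by (rule ex1I[of _ "(order 0 ?p, degree ?p, \<lambda>u. nat (coeff ?p u))"]) (auto simp: desc)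
  have "coeff ?p 0 = 0"
    using monom_1_dvd_iff[OF word_poly_nonzero, of 1 w] monom_1_dvd_iff'[of 1 ?p]
      order_word_poly[of w] by simp
  then have alt: "(\<Sum>u=1..degree ?p. (- 1) ^ (degree ?p - u) * coeff ?p u) = 1"
    using alternating_sum_coeffs word_poly_neg_one by blast
  have field: "card (Field X) = degree ?p"
    using counts by (simp add: structure_counts_def degree_word_poly)
  show ?thesis
  proof (intro conjI allI impI series unique)
    fix i k d
    assume "zeta_description (order_series X) (i, k, d)"
    then have ikd: "i = order 0 ?p" "k = degree ?p" "d = (\<lambda>u. nat (coeff ?p u))"
      by (simp_all add: desc)
    then have i: "i = 1 + count_Conc w + 2 * count_D w"
      and k: "k = 1 + count_Conc w + 3 * count_D w"
      by (simp_all only: order_word_poly degree_word_poly)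
    show "i = max_chain_card X" "int k - int i = betti_number (Field X) (hasse_edges X)"
      "int k - int i = int (count_D w)" "int i - 2 * (int k - int i) - 1 = int (count_Conc w)"
      "int i - 2 * (int k - int i) - 1 + 1 = int (count_leaves w)"
      by (simp_all add: i k chain betti leaves)
    show "k = card (Field X)" by (simp only: ikd field)
    show "(\<Sum>u=1..k. (- 1) ^ (k - u) * int (d u)) = 1"
      using alt by (simp only: ikd word_poly_nonneg int_nat_eq if_True)
  qed
qed

end
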